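(* Let $(G,\upsilon,\varepsilon)$ be a loopless weighted multigraph with at least one edge and let $\lambda_n$ be its largest weighted Laplacian eigenvalue. Then $$\chi(G)\ge\frac{\lambda_n}{\lambda_n-\frac{2\varepsilon(E)}{\upsilon(V)}}.$$
   Context: A graph is a finite multigraph with vertex set $V$ and edge set $E$ (multiple edges allowed). A weighted multigraph $(G,\upsilon,\varepsilon)$ is a graph $G$ with vertex weights $\upsilon:V\to\mathbb R_{>0}$ and edge weights $\varepsilon:E\to\mathbb R_{>0}$; $\upsilon(V)=\sum_{v\in V}\upsilon(v)$ and $\varepsilon(E)=\sum_{e\in E}\varepsilon(e)$. For $u,v\in V$, $\varepsilon(u,v)$ is the total edge weight between $u$ and $v$, and $d_{(G,\varepsilon)}(u)=\sum_{v\in V}\varepsilon(u,v)$. The combinatorial Laplacian is the $V\times V$ matrix $L_{(G,\varepsilon)}=D_{(G,\varepsilon)}-A_{(G,\varepsilon)}$, where $A_{(G,\varepsilon)}=(\varepsilon(u,v))_{u,v}$ and $D_{(G,\varepsilon)}$ is diagonal with entries $d_{(G,\varepsilon)}(v)$. The weighted Laplacian is $L_{(G,\upsilon,\varepsilon)}=W_\upsilon^{-1}L_{(G,\varepsilon)}$, where $W_\upsilon$ is the diagonal matrix with entries $\upsilon(v)$; it is self-adjoint for the inner product $\langle f,g\rangle=\sum_{v}f(v)g(v)\upsilon(v)$, so its eigenvalues are real. $\chi(G)$ is the chromatic number: the least $t\in\mathbb Z_{>0}$ for which there is a map $\kappa:V\to\{1,\dots,t\}$ with $\kappa(u)\ne\kappa(v)$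 whenever $u,v$ are joined by an edge. *)

theory Defs
  imports "HOL-Analysis.Analysis"
begin

text \<open>
  The vertex set is the whole (finite) type \<open>'v\<close>, so that \<open>V \<times> V\<close> matrices are of type
  \<open>real ^ 'v ^ 'v\<close>. The edge set \<open>E\<close> is a finite set of edge names, and \<open>ends e\<close> is the set of
  endpoints of \<open>e\<close>: a singleton if \<open>e\<close> is a loop, a pair otherwise. Parallel edges are
  different names with equal \<open>ends\<close>.
\<close>

locale multigraph =
  fixes E :: "'e set" and ends :: "'e \<Rightarrow> 'v::finite set"
  assumes finite_edges: "finite E"
    and card_ends: "e \<in> E \<Longrightarrow> card (ends e) \<in> {1, 2}"

locale loopless_multigraph = multigraph +
  assumes no_loops: "e \<in> E \<Longrightarrow> card (ends e) \<noteq> 1"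

locale weighted_multigraph = multigraph E ends
  for E :: "'e set" and ends :: "'e \<Rightarrow> 'v::finite set" +
  fixes \<upsilon> :: "'v \<Rightarrow> real" and \<epsilon> :: "'e \<Rightarrow> real"
  assumes vertex_weight_pos: "\<upsilon> v > 0"
    and edge_weight_pos: "e \<in> E \<Longrightarrow> \<epsilon> e > 0"

locale loopless_weighted_multigraph =
  weighted_multigraph E ends \<upsilon> \<epsilon> + loopless_multigraph E ends
  for E :: "'e set" and ends :: "'e \<Rightarrow> 'v::finite set" and \<upsilon> \<epsilon>

definition weight_between ::
    "'e set \<Rightarrow> ('e \<Rightarrow> 'v set) \<Rightarrow> ('e \<Rightarrow> real) \<Rightarrow> 'v \<Rightarrow> 'v \<Rightarrow> real" where
  "weight_between E ends \<epsilon> u v = (\<Sum>e | e \<in> E \<and> ends e = {u, v}. \<epsilon> e)"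

definition weighted_degree ::
    "'e set \<Rightarrow> ('e \<Rightarrow> 'v::finite set) \<Rightarrow> ('e \<Rightarrow> real) \<Rightarrow> 'v \<Rightarrow> real" where
  "weighted_degree E ends \<epsilon> u = (\<Sum>v\<in>UNIV. weight_between E ends \<epsilon> u v)"

definition diagonal_matrix :: "('v \<Rightarrow> real) \<Rightarrow> real ^ 'v ^ 'v" where
  "diagonal_matrix f = (\<chi> u v. if u = v then f u else 0)"

definition adjacency_matrix ::
    "'e set \<Rightarrow> ('e \<Rightarrow> 'v::finite set) \<Rightarrow> ('e \<Rightarrow> real) \<Rightarrow> real ^ 'v ^ 'v" where
  "adjacency_matrix E ends \<epsilon> = (\<chi> u v. weight_between E ends \<epsilon> u v)"

definition combinatorial_laplacian ::
    "'e set \<Rightarrow> ('e \<Rightarrow> 'v::finite set) \<Rightarrow> ('e \<Rightarrow> real) \<Rightarrow> real ^ 'v ^ 'v" where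
  "combinatorial_laplacian E ends \<epsilon> =
     diagonal_matrix (weighted_degree E ends \<epsilon>) - adjacency_matrix E ends \<epsilon>"

definition weighted_laplacian ::
    "'e set \<Rightarrow> ('e \<Rightarrow> 'v::finite set) \<Rightarrow> ('v \<Rightarrow> real) \<Rightarrow> ('e \<Rightarrow> real) \<Rightarrow> real ^ 'v ^ 'v" where
  "weighted_laplacian E ends \<upsilon> \<epsilon> =
     matrix_inv (diagonal_matrix \<upsilon>) ** combinatorial_laplacian E ends \<epsilon>"

definition eigenvalue :: "real ^ 'v ^ 'v \<Rightarrow> real \<Rightarrow> bool" where
  "eigenvalue M k \<longleftrightarrow> (\<exists>f. f \<noteq> 0 \<and> M *v f = k *\<^sub>R f)"

text \<open>
  \<open>Max\<close> is meaningful here: a matrix has finitely many eigenvalues, all eigenvalues of the weighted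
  Laplacian are real, and \<open>0\<close> is one of them.
\<close>

definition largest_laplacian_eigenvalue ::
    "'e set \<Rightarrow> ('e \<Rightarrow> 'v::finite set) \<Rightarrow> ('v \<Rightarrow> real) \<Rightarrow> ('e \<Rightarrow> real) \<Rightarrow> real" where
  "largest_laplacian_eigenvalue E ends \<upsilon> \<epsilon> = Max {k. eigenvalue (weighted_laplacian E ends \<upsilon> \<epsilon>) k}"

definition proper_colouring ::
    "'e set \<Rightarrow> ('e \<Rightarrow> 'v set) \<Rightarrow> nat \<Rightarrow> ('v \<Rightarrow> nat) \<Rightarrow> bool" where
  "proper_colouring E ends t \<kappa> \<longleftrightarrow>
     range \<kappa> \<subseteq> {1..t} \<and> (\<forall>u v. (\<exists>e\<in>E. ends e = {u, v}) \<longrightarrow> \<kappa> u \<noteq> \<kappa> v)"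

text \<open>The least \<open>t\<close> exists for every loopless multigraph; with a loop there is no proper colouring.\<close>

definition chromatic_number :: "'e set \<Rightarrow> ('e \<Rightarrow> 'v set) \<Rightarrow> nat" where
  "chromatic_number E ends = (LEAST t. t > 0 \<and> (\<exists>\<kappa>. proper_colouring E ends t \<kappa>))"

end

theory Submission
  imports Defs
begin

text \<open>
  Write \<open>L\<close> for the combinatorial Laplacian, \<open>W\<close> for the diagonal matrix of vertex weights and
  \<open>\<lambda>\<close> for the largest eigenvalue of \<open>W\<^sup>-\<^sup>1 L\<close>. The variational description of \<open>\<lambda>\<close> says that
  \<open>f \<bullet> L f \<le> \<lambda> (f \<bullet> W f)\<close> for every \<open>f\<close> (\<open>weighted_Rayleigh_le_Max_eigenvalue\<close>), so every
  choice of test vectors gives a lower bound on \<open>\<lambda>\<close>.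

  Given a proper colouring \<open>\<kappa>\<close> with \<open>t\<close> colours, take for each colour \<open>i\<close> the vector \<open>g\<^sub>i\<close> equal
  to \<open>1 - t\<close> on the colour class of \<open>i\<close> and to \<open>1\<close> elsewhere, and add the \<open>t\<close> inequalities. The
  vectors \<open>(g\<^sub>1 v, \<dots>, g\<^sub>t v)\<close>, one for each vertex \<open>v\<close>, point to the corners of a regular simplex:
  the inner product of those at \<open>u\<close> and \<open>v\<close> is \<open>t (t - 1)\<close> if \<open>u\<close> and \<open>v\<close> have the same colour
  and \<open>- t\<close> otherwise (\<open>sum_colour_test_vector_mult\<close>). Hence the weighted norms add up to
  \<open>t (t - 1) \<upsilon>(V)\<close>, and, as an edge always joins two different colours, the Laplacian forms add up
  to \<open>t\<^sup>2 \<cdot> 2 \<epsilon>(E)\<close>. Therefore \<open>t \<cdot> 2 \<epsilon>(E) \<le> \<lambda> (t - 1) \<upsilon>(V)\<close> (\<open>proper_colouring_bound\<close>), which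
  for \<open>t = \<chi>(G)\<close> rearranges to the claim.

  The variational inequality is reduced to a symmetric matrix, since \<open>W\<^sup>-\<^sup>1 L\<close> is similar to
  \<open>W\<^sup>-\<^sup>1\<^sup>/\<^sup>2 L W\<^sup>-\<^sup>1\<^sup>/\<^sup>2\<close>. For a symmetric matrix the quadratic form attains a maximum on
  the unit sphere, the maximum is an eigenvalue, and orthogonality of eigenvectors leaves only
  finitely many eigenvalues, so that \<open>Max\<close> really bounds this one.
\<close>

section \<open>The largest eigenvalue of a symmetric matrix\<close>

lemma symmetric_matrix_inner:
  fixes N :: "real ^ 'n ^ 'n"
  assumes "transpose N = N"
  shows "x \<bullet> (N *v y) = (N *v x) \<bullet> y"
  by (metis assms dot_lmul_matrix transpose_matrix_vector)

text \<open>
  Eigenvectors for different eigenvalues are orthogonal, hence linearly independent, and a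
  Euclidean space has no infinite independent set.
\<close>
lemma finite_eigenvalues_symmetric:
  fixes N :: "real ^ 'n ^ 'n"
  assumes sym: "transpose N = N"
  shows "finite {k. eigenvalue N k}"
proof -
  let ?S = "{k. eigenvalue N k}"
  have "\<forall>k\<in>?S. \<exists>f. f \<noteq> 0 \<and> N *v f = k *\<^sub>R f"
    by (simp add: eigenvalue_def)
  then obtain F where F: "\<And>k. k \<in> ?S \<Longrightarrow> F k \<noteq> 0 \<and> N *v F k = k *\<^sub>R F k"
    by metis
  have orth: "F k \<bullet> F l = 0" if "k \<in> ?S" "l \<in> ?S" "k \<noteq> l" for k l
  proof -
    have "l * (F k \<bullet> F l) = k * (F k \<bullet> F l)"
      using symmetric_matrix_inner[OF sym, of "F k" "F l"] F that by auto
    then show ?thesis using \<open>k \<noteq> l\<close> by simp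
  qed
  have "inj_on F ?S"
    using orth F by (intro inj_onI) (metis inner_eq_zero_iff)
  moreover have "pairwise orthogonal (F ` ?S)" "0 \<notin> F ` ?S"
    using orth F by (auto simp: pairwise_image orthogonal_def pairwise_def)
  then have "finite (F ` ?S)"
    using pairwise_orthogonal_independent independent_imp_finite by blast
  ultimately show ?thesis
    using finite_imageD by blast
qed

lemma quadratic_form_scaleR:
  fixes N :: "real ^ 'n ^ 'n"
  shows "(c *\<^sub>R x) \<bullet> (N *v (c *\<^sub>R x)) = c\<^sup>2 * (x \<bullet> (N *v x))"
  by (simp add: matrix_vector_mult_scaleR power2_eq_square)

text \<open>
  The value \<open>\<mu>\<close> is the maximum of the quadratic form on the unit sphere, which exists by
  compactness. If a maximiser \<open>f\<close> had a residual \<open>r = N f - \<mu> f \<noteq> 0\<close>, then moving from \<open>f\<close> a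
  little in the direction of \<open>r\<close> would make the quotient larger than \<open>\<mu>\<close>: the gain is of first
  order in the step \<open>s\<close>, the loss of second order.
\<close>
lemma symmetric_Rayleigh_maximum:
  fixes N :: "real ^ 'n ^ 'n"
  assumes sym: "transpose N = N"
  obtains \<mu> where "eigenvalue N \<mu>" and "\<And>x. x \<bullet> (N *v x) \<le> \<mu> * (x \<bullet> x)"
proof -
  let ?S = "sphere (0 :: real ^ 'n) 1"
  have "continuous_on ?S (\<lambda>x. x \<bullet> (N *v x))"
    by (intro continuous_intros matrix_vector_mult_linear_continuous_on)
  moreover have "?S \<noteq> {}" by simp
  ultimately obtain f where f: "f \<in> ?S" and f_max: "\<And>x. x \<in> ?S \<Longrightarrow> x \<bullet> (N *v x) \<le> f \<bullet> (N *v f)"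
    using continuous_attains_sup[OF compact_sphere] by blast
  define \<mu> where "\<mu> = f \<bullet> (N *v f)"
  have bound: "x \<bullet> (N *v x) \<le> \<mu> * (x \<bullet> x)" for x
  proof (cases "x = 0")
    case False
    let ?u = "x /\<^sub>R norm x"
    have "?u \<bullet> (N *v ?u) \<le> \<mu>"
      using False f_max[of ?u] by (simp add: \<mu>_def)
    moreover have "x \<bullet> (N *v x) = (norm x)\<^sup>2 * (?u \<bullet> (N *v ?u))"
      using False quadratic_form_scaleR[of "norm x" ?u N] by simp
    ultimately have "x \<bullet> (N *v x) \<le> (norm x)\<^sup>2 * \<mu>"
      by (simp add: mult_left_mono)
    then show ?thesis by (simp add: power2_norm_eq_inner mult.commute)
  qed simp
  define r where "r = N *v f - \<mu> *\<^sub>R f"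
  have ff: "f \<bullet> f = 1" using f by (simp add: norm_eq_1)
  have ineq: "s * (2 * (r \<bullet> r)) \<le> s\<^sup>2 * (\<mu> * (r \<bullet> r) - r \<bullet> (N *v r))" for s :: real
  proof -
    have "(f + s *\<^sub>R r) \<bullet> (N *v (f + s *\<^sub>R r))
        = \<mu> + 2 * s * (r \<bullet> (N *v f)) + s\<^sup>2 * (r \<bullet> (N *v r))"
      using symmetric_matrix_inner[OF sym, of f r]
      by (simp add: \<mu>_def matrix_vector_right_distrib matrix_vector_mult_scaleR
          inner_add_left inner_add_right inner_commute power2_eq_square algebra_simps)
    moreover have "(f + s *\<^sub>R r) \<bullet> (f + s *\<^sub>R r) = 1 + 2 * s * (r \<bullet> f) + s\<^sup>2 * (r \<bullet> r)"
      using ff by (simp add: inner_add_left inner_add_right inner_commute power2_eq_square algebra_simps)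
    moreover have "r \<bullet> (N *v f) = r \<bullet> r + \<mu> * (r \<bullet> f)"
      by (simp add: r_def inner_diff_left inner_diff_right inner_commute algebra_simps)
    ultimately show ?thesis
      using bound[of "f + s *\<^sub>R r"] by (simp only:) (simp add: algebra_simps)
  qed
  define C where "C = \<mu> * (r \<bullet> r) - r \<bullet> (N *v r)"
  have "r = 0"
  proof (rule ccontr)
    assume "r \<noteq> 0"
    then have r_pos: "r \<bullet> r > 0" by simp
    \<comment> \<open>The step is so small that the loss \<open>s * C\<close> is at most half of the gain \<open>2 * (r \<bullet> r)\<close>.\<close>
    define s where "s = (r \<bullet> r) / (\<bar>C\<bar> + 1)"
    have "s > 0" using r_pos by (simp add: s_def add_nonneg_pos)
    moreover have "s * (2 * (r \<bullet> r)) \<le> s * (s * C)"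
      using ineq[of s] by (simp only: C_def[symmetric] power2_eq_square mult.assoc)
    ultimately have "2 * (r \<bullet> r) \<le> s * C" by simp
    also have "\<dots> \<le> s * (\<bar>C\<bar> + 1)"
      using \<open>s > 0\<close> by (intro mult_left_mono) auto
    also have "\<dots> = r \<bullet> r"
      by (simp add: s_def add_nonneg_pos less_imp_neq[symmetric])
    finally show False using r_pos by simp
  qed
  then have "eigenvalue N \<mu>"
    using ff by (auto simp: eigenvalue_def r_def intro!: exI[of _ f])
  with bound show ?thesis using that by blast
qed

lemma Rayleigh_le_Max_eigenvalue:
  fixes N :: "real ^ 'n ^ 'n"
  assumes sym: "transpose N = N"
  shows "x \<bullet> (N *v x) \<le> Max {k. eigenvalue N k} * (x \<bullet> x)"
proof -
  obtain \<mu> where \<mu>: "eigenvalue N \<mu>" "x \<bullet> (N *v x) \<le> \<mu> * (x \<bullet> x)"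
    using symmetric_Rayleigh_maximum[OF sym] by metis
  then have "\<mu> \<le> Max {k. eigenvalue N k}"
    using finite_eigenvalues_symmetric[OF sym] by simp
  then show ?thesis using \<mu>(2) by (meson inner_ge_zero mult_right_mono order_trans)
qed

section \<open>The weighted eigenvalue problem\<close>

lemma diagonal_matrix_mult_vector: "diagonal_matrix a *v f = (\<chi> v. a v * f $ v)"
  by (simp add: vec_eq_iff diagonal_matrix_def matrix_vector_mult_def if_distribR if_distrib[of "\<lambda>x. x * _"] cong: if_cong)

lemma diagonal_matrix_mult:
  "diagonal_matrix a ** diagonal_matrix b = diagonal_matrix (\<lambda>v. a v * b v)"
  by (simp add: matrix_eq diagonal_matrix_mult_vector mult.assoc flip: matrix_vector_mul_assoc)

lemma diagonal_matrix_1: "diagonal_matrix (\<lambda>v. 1) = mat 1"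
  by (simp add: diagonal_matrix_def mat_def)

lemma matrix_inv_eqI:
  fixes A :: "'a::semiring_1 ^ 'n ^ 'm"
  assumes "A ** B = mat 1" and "B ** A = mat 1"
  shows "matrix_inv A = B"
proof -
  have "\<exists>A'. A ** A' = mat 1 \<and> A' ** A = mat 1"
    using assms by blast
  from someI_ex[OF this] have inv: "A ** matrix_inv A = mat 1"
    unfolding matrix_inv_def by (rule conjunct1)
  have "matrix_inv A = (B ** A) ** matrix_inv A"
    by (simp only: assms(2) matrix_mul_lid)
  also have "\<dots> = B"
    by (simp only: inv matrix_mul_rid flip: matrix_mul_assoc)
  finally show ?thesis .
qed

lemma matrix_inv_diagonal_matrix:
  assumes "\<And>v. a v \<noteq> 0"
  shows "matrix_inv (diagonal_matrix a) = diagonal_matrix (\<lambda>v. inverse (a v))"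
  using assms by (intro matrix_inv_eqI) (simp_all add: diagonal_matrix_mult diagonal_matrix_1)

lemma transpose_diagonal_matrix: "transpose (diagonal_matrix a) = diagonal_matrix a"
  by (auto simp: transpose_def diagonal_matrix_def vec_eq_iff)

text \<open>
  With \<open>D = W\<^sup>1\<^sup>/\<^sup>2\<close> and \<open>R = W\<^sup>-\<^sup>1\<^sup>/\<^sup>2\<close>, the matrix \<open>W\<^sup>-\<^sup>1 L = R (R L R) D\<close> is similar to the
  symmetric matrix \<open>R L R\<close>, so both have the same eigenvalues. The substitution \<open>x = D f\<close> turns the
  quadratic form of \<open>R L R\<close> into that of \<open>L\<close> and the Euclidean norm into the weighted one.
\<close>
lemma weighted_Rayleigh_le_Max_eigenvalue:
  fixes L :: "real ^ 'v ^ 'v"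
  assumes sym: "transpose L = L" and pos: "\<And>v. \<upsilon> v > 0"
  shows "f \<bullet> (L *v f) \<le> Max {k. eigenvalue (matrix_inv (diagonal_matrix \<upsilon>) ** L) k} * (\<Sum>v\<in>UNIV. \<upsilon> v * (f $ v)\<^sup>2)"
proof -
  define D where "D = diagonal_matrix (\<lambda>v. sqrt (\<upsilon> v))"
  define R where "R = diagonal_matrix (\<lambda>v. inverse (sqrt (\<upsilon> v)))"
  have nz: "sqrt (\<upsilon> v) \<noteq> 0" for v using pos[of v] by simp
  have DR: "D ** R = mat 1" and RD: "R ** D = mat 1"
    using nz by (simp_all add: D_def R_def diagonal_matrix_mult diagonal_matrix_1)
  have "inverse (\<upsilon> v) = inverse (sqrt (\<upsilon> v)) * inverse (sqrt (\<upsilon> v))" for v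
    using pos[of v] by (simp flip: inverse_mult_distrib add: less_imp_le)
  then have inv: "matrix_inv (diagonal_matrix \<upsilon>) = R ** R"
    using pos matrix_inv_diagonal_matrix[of \<upsilon>] by (simp add: R_def diagonal_matrix_mult less_imp_neq[symmetric])
  define N where "N = R ** L ** R"
  have eq: "eigenvalue (R ** R ** L) k \<longleftrightarrow> eigenvalue N k" for k
  proof 
    assume "eigenvalue (R ** R ** L) k"
    then obtain g where g: "g \<noteq> 0" "(R ** R ** L) *v g = k *\<^sub>R g" by (auto simp: eigenvalue_def)
    have "N *v (D *v g) = D *v ((R ** R ** L) *v g)"
      unfolding N_def by (metis DR RD matrix_mul_assoc matrix_mul_lid matrix_mul_rid matrix_vector_mul_assoc)
    moreover have "D *v g \<noteq> 0"
      by (metis RD g(1) matrix_vector_mul_assoc matrix_vector_mul_lid matrix_vector_mult_0_right)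
    ultimately show "eigenvalue N k" 
      using g(2) by (auto simp: eigenvalue_def matrix_vector_mult_scaleR)
  next
    assume "eigenvalue N k"
    then obtain g where g: "g \<noteq> 0" "N *v g = k *\<^sub>R g" by (auto simp: eigenvalue_def)
    have "(R ** R ** L) *v (R *v g) = R *v (N *v g)"
      unfolding N_def by (simp add: matrix_vector_mul_assoc matrix_mul_assoc)
    moreover have "R *v g \<noteq> 0"
      by (metis DR g(1) matrix_vector_mul_assoc matrix_vector_mul_lid matrix_vector_mult_0_right)
    ultimately show "eigenvalue (R ** R ** L) k"
      using g(2) by (auto simp: eigenvalue_def matrix_vector_mult_scaleR)
  qed
  have symR: "transpose R = R" by (simp add: R_def transpose_diagonal_matrix)
  have symN: "transpose N = N"
    by (simp add: N_def matrix_transpose_mul symR sym matrix_mul_assoc)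
  have "(D *v f) \<bullet> (N *v (D *v f)) = f \<bullet> (L *v f)"
  proof -
    have "N *v (D *v f) = R *v (L *v f)"
      unfolding N_def by (metis RD matrix_mul_assoc matrix_mul_rid matrix_vector_mul_assoc)
    then have "(D *v f) \<bullet> (N *v (D *v f)) = (R *v (D *v f)) \<bullet> (L *v f)"
      by (simp only: symmetric_matrix_inner[OF symR])
    then show ?thesis
      by (simp only: matrix_vector_mul_assoc RD matrix_vector_mul_lid)
  qed
  moreover have "(D *v f) \<bullet> (D *v f) = (\<Sum>v\<in>UNIV. \<upsilon> v * (f $ v)\<^sup>2)"
    using pos by (simp add: D_def diagonal_matrix_mult_vector inner_vec_def power_mult_distrib less_imp_le flip: power2_eq_square)
  ultimately show ?thesis
    using Rayleigh_le_Max_eigenvalue[OF symN, of "D *v f"] by (simp add: inv eq)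
qed

section \<open>Test vectors from a colouring\<close>

text \<open>
  Handshaking: a non-loop edge is counted once for each of the two orders of its end points. A loop
  would be counted only once.
\<close>
lemma sum_weighted_degree:
  assumes "loopless_multigraph E (ends :: 'e \<Rightarrow> 'v::finite set)"
  shows "(\<Sum>u\<in>UNIV. weighted_degree E ends \<epsilon> u) = 2 * (\<Sum>e\<in>E. \<epsilon> e)"
proof -
  interpret loopless_multigraph E ends by fact
  have "(\<Sum>u\<in>UNIV. weighted_degree E ends \<epsilon> u)
      = (\<Sum>p\<in>UNIV \<times> UNIV. weight_between E ends \<epsilon> (fst p) (snd p))"
    by (simp add: weighted_degree_def sum.cartesian_product case_prod_beta)
  also have "\<dots> = (\<Sum>p\<in>UNIV. \<Sum>e\<in>E. if ends e = {fst p, snd p} then \<epsilon> e else 0)"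
    using finite_edges by (simp add: weight_between_def sum.inter_filter)
  also have "\<dots> = (\<Sum>e\<in>E. \<Sum>p\<in>UNIV. if ends e = {fst p, snd p} then \<epsilon> e else 0)"
    by (rule sum.swap)
  also have "\<dots> = (\<Sum>e\<in>E. 2 * \<epsilon> e)"
  proof (rule sum.cong[OF refl])
    fix e assume "e \<in> E"
    then have "card (ends e) = 2"
      using card_ends no_loops by blast
    then obtain a b where ab: "ends e = {a, b}" "a \<noteq> b" by (meson card_2_iff)
    have "{p. ends e = {fst p, snd p}} = {(a, b), (b, a)}"
      unfolding ab(1) by (auto simp: doubleton_eq_iff)
    then show "(\<Sum>p\<in>UNIV. if ends e = {fst p, snd p} then \<epsilon> e else 0) = 2 * \<epsilon> e"
      using \<open>a \<noteq> b\<close> by (simp flip: sum.inter_filter)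
  qed
  finally show ?thesis by (simp add: sum_distrib_left)
qed

lemma combinatorial_laplacian_mult_vector:
  "(combinatorial_laplacian E ends \<epsilon> *v f) $ u
    = weighted_degree E ends \<epsilon> u * f $ u - (\<Sum>v\<in>UNIV. weight_between E ends \<epsilon> u v * f $ v)"
proof -
  have "(adjacency_matrix E ends \<epsilon> *v f) $ u = (\<Sum>v\<in>UNIV. weight_between E ends \<epsilon> u v * f $ v)"
    by (simp add: adjacency_matrix_def matrix_vector_mult_def)
  then show ?thesis
    by (simp add: combinatorial_laplacian_def matrix_vector_mult_diff_rdistrib diagonal_matrix_mult_vector)
qed

lemma transpose_combinatorial_laplacian:
  "transpose (combinatorial_laplacian E ends \<epsilon>) = combinatorial_laplacian E ends \<epsilon>"
  by (auto simp: combinatorial_laplacian_def transpose_def diagonal_matrix_def adjacency_matrix_def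
      vec_eq_iff weight_between_def insert_commute)

text \<open>
  This is the all-ones vector minus \<open>t\<close> times the indicator of a colour class. The factor \<open>t\<close> makes
  the sum over all \<open>t\<close> colours vanish at each vertex.
\<close>
definition colour_test_vector :: "nat \<Rightarrow> ('v \<Rightarrow> nat) \<Rightarrow> nat \<Rightarrow> real ^ 'v" where
  "colour_test_vector t \<kappa> i = (\<chi> v. 1 - (if \<kappa> v = i then real t else 0))"

lemma sum_colour_test_vector_mult:
  assumes "\<kappa> u \<in> {1..t}" "\<kappa> v \<in> {1..t}"
  shows "(\<Sum>i=1..t. colour_test_vector t \<kappa> i $ u * colour_test_vector t \<kappa> i $ v)
    = (if \<kappa> u = \<kappa> v then real t * (real t - 1) else - real t)"
proof -
  have "(\<Sum>i=1..t. colour_test_vector t \<kappa> i $ u * colour_test_vector t \<kappa> i $ v)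
    = (\<Sum>i=1..t. 1 - (if \<kappa> u = i then real t else 0) - (if \<kappa> v = i then real t else 0)
        + (if \<kappa> u = i then if \<kappa> u = \<kappa> v then (real t)\<^sup>2 else 0 else 0))"
    by (intro sum.cong) (auto simp: colour_test_vector_def algebra_simps power2_eq_square)
  also have "\<dots> = (if \<kappa> u = \<kappa> v then real t * (real t - 1) else - real t)"
    using assms by (simp add: sum.distrib sum_subtractf power2_eq_square algebra_simps)
  finally show ?thesis .
qed

text \<open>
  The diagonal of the Laplacian contributes \<open>t (t - 1)\<close> per unit of degree. Every
  edge joins different colours, so the off-diagonal entries contribute another \<open>t\<close>.
\<close>
lemma sum_colour_test_vector_laplacian:
  assumes "loopless_multigraph E (ends :: 'e \<Rightarrow> 'v::finite set)" and col: "proper_colouring E ends t \<kappa>"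
  shows "(\<Sum>i=1..t. colour_test_vector t \<kappa> i \<bullet> (combinatorial_laplacian E ends \<epsilon> *v colour_test_vector t \<kappa> i))
    = (real t)\<^sup>2 * (2 * (\<Sum>e\<in>E. \<epsilon> e))"
proof -
  let ?g = "colour_test_vector t \<kappa>" and ?w = "weight_between E ends \<epsilon>" and ?d = "weighted_degree E ends \<epsilon>"
  have range: "\<kappa> v \<in> {1..t}" for v using col unfolding proper_colouring_def by blast
  have non: "?w u v = 0" if "\<kappa> u = \<kappa> v" for u v
    using col that by (auto simp: proper_colouring_def weight_between_def intro!: sum.neutral)
  have "(\<Sum>i=1..t. ?g i \<bullet> (combinatorial_laplacian E ends \<epsilon> *v ?g i))
      = (\<Sum>i=1..t. \<Sum>u\<in>UNIV. ?d u * (?g i $ u * ?g i $ u) - (\<Sum>v\<in>UNIV. ?w u v * (?g i $ u * ?g i $ v)))"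
    by (simp add: inner_vec_def combinatorial_laplacian_mult_vector right_diff_distrib sum_distrib_left mult_ac)
  also have "\<dots> = (\<Sum>u\<in>UNIV. ?d u * (\<Sum>i=1..t. ?g i $ u * ?g i $ u)
        - (\<Sum>v\<in>UNIV. ?w u v * (\<Sum>i=1..t. ?g i $ u * ?g i $ v)))"
  proof (subst sum.swap, rule sum.cong[OF refl])
    fix u
    show "(\<Sum>i=1..t. ?d u * (?g i $ u * ?g i $ u) - (\<Sum>v\<in>UNIV. ?w u v * (?g i $ u * ?g i $ v)))
      = ?d u * (\<Sum>i=1..t. ?g i $ u * ?g i $ u) - (\<Sum>v\<in>UNIV. ?w u v * (\<Sum>i=1..t. ?g i $ u * ?g i $ v))"
      unfolding sum_subtractf sum_distrib_left by (subst sum.swap) (rule refl)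
  qed
  also have "\<dots> = (\<Sum>u\<in>UNIV. ?d u * (real t * (real t - 1)) - (\<Sum>v\<in>UNIV. ?w u v * (- real t)))"
  proof -
    have "?w u v * (\<Sum>i=1..t. ?g i $ u * ?g i $ v) = ?w u v * (- real t)" for u v
      unfolding sum_colour_test_vector_mult[OF range range] using non[of u v] by auto
    moreover have "(\<Sum>i=1..t. ?g i $ u * ?g i $ u) = real t * (real t - 1)" for u
      unfolding sum_colour_test_vector_mult[OF range range] by simp
    ultimately show ?thesis by presburger
  qed
  also have "\<dots> = (\<Sum>u\<in>UNIV. (real t)\<^sup>2 * ?d u)"
    by (simp add: weighted_degree_def sum_negf algebra_simps power2_eq_square flip: sum_distrib_left)
  finally show ?thesis
    by (simp add: sum_weighted_degree[OF assms(1)] flip: sum_distrib_left)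
qed

lemma sum_colour_test_vector_norm:
  assumes "range \<kappa> \<subseteq> {1..t}"
  shows "(\<Sum>i=1..t. \<Sum>v\<in>UNIV. \<upsilon> v * (colour_test_vector t \<kappa> i $ v)\<^sup>2)
    = (\<Sum>v\<in>UNIV. \<upsilon> v) * (real t * (real t - 1))"
proof -
  have range: "\<kappa> v \<in> {1..t}" for v using assms by blast
  have "(\<Sum>i=1..t. \<Sum>v\<in>UNIV. \<upsilon> v * (colour_test_vector t \<kappa> i $ v)\<^sup>2)
      = (\<Sum>v\<in>UNIV. \<upsilon> v * (\<Sum>i=1..t. colour_test_vector t \<kappa> i $ v * colour_test_vector t \<kappa> i $ v))"
    by (subst sum.swap) (simp add: sum_distrib_left power2_eq_square)
  also have "\<dots> = (\<Sum>v\<in>UNIV. \<upsilon> v * (real t * (real t - 1)))"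
    by (simp only: sum_colour_test_vector_mult[OF range range] if_True refl)
  finally show ?thesis
    by (simp only: sum_distrib_right)
qed

section \<open>The bound on the chromatic number\<close>

text \<open>The variational inequality, added up over the test vectors of all colours and divided by \<open>t\<close>.\<close>
lemma proper_colouring_bound:
  assumes G: "loopless_weighted_multigraph E (ends :: 'e \<Rightarrow> 'v::finite set) \<upsilon> \<epsilon>"
    and col: "proper_colouring E ends t \<kappa>" and "t > 0"
  shows "real t * (2 * (\<Sum>e\<in>E. \<epsilon> e)) \<le> largest_laplacian_eigenvalue E ends \<upsilon> \<epsilon> * (real t - 1) * (\<Sum>v\<in>UNIV. \<upsilon> v)"
proof -
  interpret loopless_weighted_multigraph E ends \<upsilon> \<epsilon> by fact
  have lm: "loopless_multigraph E ends" by unfold_locales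
  let ?lam = "largest_laplacian_eigenvalue E ends \<upsilon> \<epsilon>"
  have "(real t)\<^sup>2 * (2 * (\<Sum>e\<in>E. \<epsilon> e)) \<le> (\<Sum>i=1..t. ?lam * (\<Sum>v\<in>UNIV. \<upsilon> v * (colour_test_vector t \<kappa> i $ v)\<^sup>2))"
    unfolding sum_colour_test_vector_laplacian[OF lm col, symmetric]
      largest_laplacian_eigenvalue_def weighted_laplacian_def
    by (intro sum_mono weighted_Rayleigh_le_Max_eigenvalue transpose_combinatorial_laplacian vertex_weight_pos)
  also have "\<dots> = ?lam * ((\<Sum>v\<in>UNIV. \<upsilon> v) * (real t * (real t - 1)))"
    using col by (subst sum_distrib_left[symmetric], subst sum_colour_test_vector_norm) (auto simp: proper_colouring_def)
  finally have "real t * (real t * (2 * (\<Sum>e\<in>E. \<epsilon> e))) \<le> real t * (?lam * (real t - 1) * (\<Sum>v\<in>UNIV. \<upsilon> v))"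
    by (simp add: power2_eq_square algebra_simps)
  then show ?thesis using \<open>t > 0\<close> by simp
qed

text \<open>
  Giving all vertices different colours is proper, as there are no loops; so the minimum in the
  definition of the chromatic number is taken over a nonempty set.
\<close>
lemma chromatic_number_attained:
  assumes "loopless_multigraph E (ends :: 'e \<Rightarrow> 'v::finite set)"
  shows "chromatic_number E ends > 0 \<and> (\<exists>\<kappa>. proper_colouring E ends (chromatic_number E ends) \<kappa>)"
proof -
  interpret loopless_multigraph E ends by fact
  obtain \<kappa> :: "'v \<Rightarrow> nat" where \<kappa>: "bij_betw \<kappa> UNIV {1..CARD('v)}"
    using finite_same_card_bij[of "UNIV :: 'v set" "{1..CARD('v)}"] by auto
  have "proper_colouring E ends CARD('v) \<kappa>"
    unfolding proper_colouring_def
  proof (intro conjI allI impI)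
    fix u v assume "\<exists>e\<in>E. ends e = {u, v}"
    then have "u \<noteq> v" using no_loops by force
    then show "\<kappa> u \<noteq> \<kappa> v" using \<kappa> by (auto simp: bij_betw_def dest: injD)
  qed (use \<kappa> in \<open>auto simp: bij_betw_def\<close>)
  then show ?thesis
    unfolding chromatic_number_def by (intro LeastI_ex[of "\<lambda>t. t > 0 \<and> (\<exists>\<kappa>. proper_colouring E ends t \<kappa>)"]) (auto intro!: exI[of _ "CARD('v)"])
qed

theorem theorem7p7:
  fixes E :: "'e set" and ends :: "'e \<Rightarrow> 'v::finite set"
    and \<upsilon> :: "'v \<Rightarrow> real" and \<epsilon> :: "'e \<Rightarrow> real" and lam_n :: real
  assumes "loopless_weighted_multigraph E ends \<upsilon> \<epsilon>"
    and "E \<noteq> {}"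
    and "lam_n = largest_laplacian_eigenvalue E ends \<upsilon> \<epsilon>"
  shows "real (chromatic_number E ends) \<ge>
           lam_n / (lam_n - 2 * (\<Sum>e\<in>E. \<epsilon> e) / (\<Sum>v\<in>UNIV. \<upsilon> v))"
proof -
  interpret loopless_weighted_multigraph E ends \<upsilon> \<epsilon> by fact
  define t where "t = real (chromatic_number E ends)"
  define a where "a = 2 * (\<Sum>e\<in>E. \<epsilon> e) / (\<Sum>v\<in>UNIV. \<upsilon> v)"
  have V_pos: "(\<Sum>v\<in>UNIV. \<upsilon> v) > 0"
    by (intro sum_pos vertex_weight_pos) auto
  have "(\<Sum>e\<in>E. \<epsilon> e) > 0"
    using assms(2) by (intro sum_pos finite_edges edge_weight_pos)
  then have "a > 0" using V_pos by (simp add: a_def)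
  obtain \<kappa> where \<kappa>: "chromatic_number E ends > 0" "proper_colouring E ends (chromatic_number E ends) \<kappa>"
    using chromatic_number_attained[of E ends] loopless_multigraph_axioms by blast
  have "t \<ge> 1" using \<kappa>(1) by (simp add: t_def)
  have main: "t * a \<le> lam_n * (t - 1)"
    using proper_colouring_bound[OF assms(1) \<kappa>(2,1)] V_pos
    by (simp add: a_def t_def assms(3) field_simps)
  \<comment> \<open>An edge makes \<open>a\<close> positive, which forces \<open>lam_n\<close> and then also the denominator to be positive.\<close>
  have "t * a > 0" using \<open>t \<ge> 1\<close> \<open>a > 0\<close> by simp
  then have "lam_n * (t - 1) > 0" using main by linarith
  then have "lam_n > 0" using \<open>t \<ge> 1\<close> by (simp add: zero_less_mult_iff)
  moreover have le: "lam_n \<le> t * (lam_n - a)" using main by (simp add: algebra_simps)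
  ultimately have "t * (lam_n - a) > 0" by linarith
  then have "lam_n - a > 0" using \<open>t \<ge> 1\<close> by (simp add: zero_less_mult_iff)
  then show ?thesis
    using le by (simp add: t_def a_def pos_divide_le_eq)
qed
end
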